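(* Let $s,t\ge1$ be coprime integers, and let $k=\frac12(s+1)(t-1)\in\mathbb{Z}$. Consider the affine change of variables $$z_{t,j}=\frac1t\bigl(a_{t,sj+k}-[a_{t,s(j+1)+k}-s]\bigr),\qquad j\in\mathbb{Z}/t\mathbb{Z},$$ from the hyperplane $\{(a_{t,i})_{i\in\mathbb{Z}/t\mathbb{Z}}:\sum_i a_{t,i}=\binom t2\}$ to the hyperplane $\{(z_{t,j})_{j\in\mathbb{Z}/t\mathbb{Z}}:\sum_j z_{t,j}=s\}$ of $\mathbb{R}^t$. It is an invertible affine map, carrying the simplex defined by $a_{t,i}\ge a_{t,i+s}-s$ (all $i$) onto the simplex defined by $z_{t,j}\ge0$ (all $j$), with inverse given by $$a_{t,k+\ell s}-\frac{t-1}{2}=\sum_{j=0}^{t-1}\Bigl(\frac{t-1}{2}-j\Bigr)z_{t,j+\ell},\qquad \ell\in\mathbb{Z}/t\mathbb{Z}.$$ (1) The set $\mathcal{C}_s\cap\mathcal{C}_t$ of simultaneous $s$- and $t$-cores is parameterized, via $\lambda\mapsto(a_{t,i}(\lambda))_{i\in\mathbb{Z}/t\mathbb{Z}}$, by the set $A_t(s)$ of all integer points $(a_{t,i})_{i\in\mathbb{Z}/t\mathbb{Z}}$ with $a_{t,i}\ge a_{t,i+s}-s$ and $a_{t,i}\equiv i\pmod t$ for all $i$, and $\sum_{i}a_{t,i}=\binom t2$; and the change of variables $z_{t,j}=\frac1t\bigl(a_{t,sj+k}-[a_{t,s(j+1)+k}-s]\bigr)$ ($j\in\mathbb{Z}/t\mathbb{Z}$)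 restricts to a bijection from $A_t(s)$ onto the set $\mathrm{TD}_t(s)$ of all points $(z_{t,i})_{i\in\mathbb{Z}/t\mathbb{Z}}$ with $z_{t,i}\in\mathbb{Z}$ and $z_{t,i}\ge0$ for all $i$, $\sum_i z_{t,i}=s$, and $\sum_{i\in\mathbb{Z}/t\mathbb{Z}} i\,z_{t,i}\equiv0\pmod t$. (2) The larger set $\mathcal{C}_t$ of all $t$-cores is parameterized, via $\lambda\mapsto(a_{t,i}(\lambda))_{i\in\mathbb{Z}/t\mathbb{Z}}$, by the set of all integer points $(a_{t,i})_{i\in\mathbb{Z}/t\mathbb{Z}}$ with $\sum_i a_{t,i}=\binom t2$ and $a_{t,i}\equiv i\pmod t$ for all $i$; and the same change of variables $z_{t,j}=\frac1t\bigl(a_{t,sj+k}-[a_{t,s(j+1)+k}-s]\bigr)$ ($j\in\mathbb{Z}/t\mathbb{Z}$) restricts to a bijection from this set onto the set of all points $(z_{t,i})_{i\in\mathbb{Z}/t\mathbb{Z}}$ with $z_{t,i}\in\mathbb{Z}$ for all $i$, $\sum_i z_{t,i}=s$, and $\sum_{i\in\mathbb{Z}/t\mathbb{Z}} i\,z_{t,i}\equiv0\pmod t$.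
   Context: A partition is an infinite weakly decreasing sequence $\lambda=(\lambda_1,\lambda_2,\ldots)$ of nonnegative integers with finite sum. Its Young diagram is $[\lambda]=\{(r,c)\in\mathbb{Z}_{>0}^2 : c\le\lambda_r\}$, its conjugate $\overline{\lambda}$ is given by $\overline{\lambda}_r=\#\{c\in\mathbb{Z}_{>0}: r\le\lambda_c\}$, and the hook length at $(r,c)\in[\lambda]$ is $1+(\lambda_r-r)+(\overline{\lambda}_c-c)$. A partition is a $t$-core if it has no hook of length $t$; $\mathcal{C}_t$ is the set of $t$-cores. The beta-set of $\lambda$ is $B^\lambda=\{\lambda_i-i: i\ge1\}\subset\mathbb{Z}$; $\lambda$ is a $t$-core iff $B^\lambda-t\subseteq B^\lambda$. For a $t$-core $\lambda$ and $i\in\mathbb{Z}$ (only $i$ mod $t$ matters) put $a_{t,i}(\lambda)=t+\max[B^\lambda\cap(i+t\mathbb{Z})]$. All indices of $a_{t,\cdot}$ and $z_{t,\cdot}$ are taken modulo $t$. "Parameterized" means that the indicated map is a bijection. *)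

theory Defs
  imports "HOL-Analysis.Analysis" "HOL-Library.Real_Mod" "HOL-Number_Theory.Cong"
begin

section \<open>Partitions and cores\<close>

text \<open>Partitions are indexed from 1. The value at the unused index 0 is fixed to be 0, so that
  distinct functions are distinct partitions.\<close>

definition partitions :: "(nat \<Rightarrow> nat) set" where
  "partitions = {l. l 0 = 0 \<and> (\<forall>i\<ge>1. l (i + 1) \<le> l i) \<and> summable (\<lambda>i. real (l i))}"

definition young_diagram :: "(nat \<Rightarrow> nat) \<Rightarrow> (nat \<times> nat) set" where
  "young_diagram l = {(r, c). r \<ge> 1 \<and> c \<ge> 1 \<and> c \<le> l r}"

definition conjugate :: "(nat \<Rightarrow> nat) \<Rightarrow> nat \<Rightarrow> nat" where
  "conjugate l r = (if r = 0 then 0 else card {c. c \<ge> 1 \<and> r \<le> l c})"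

definition hook_length :: "(nat \<Rightarrow> nat) \<Rightarrow> nat \<Rightarrow> nat \<Rightarrow> int" where
  "hook_length l r c = 1 + (int (l r) - int r) + (int (conjugate l c) - int c)"

definition cores :: "nat \<Rightarrow> (nat \<Rightarrow> nat) set" where
  "cores t = {l \<in> partitions. \<forall>(r, c) \<in> young_diagram l. hook_length l r c \<noteq> int t}"

definition beta_set :: "(nat \<Rightarrow> nat) \<Rightarrow> int set" where
  "beta_set l = {int (l i) - int i | i. i \<ge> 1}"

text \<open>\<open>a_coord t l i\<close> is the number $a_{t,i}(\lambda)$. The set whose maximum is taken is infinite
  but bounded above, hence \<open>GREATEST\<close> and not \<open>Max\<close>.\<close>

definition a_coord :: "nat \<Rightarrow> (nat \<Rightarrow> nat) \<Rightarrow> int \<Rightarrow> int" where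
  "a_coord t l i = int t + (GREATEST x. x \<in> beta_set l \<and> [x = i] (mod int t))"

definition a_coords :: "nat \<Rightarrow> (nat \<Rightarrow> nat) \<Rightarrow> int \<Rightarrow> real" where
  "a_coords t l = (\<lambda>i. real_of_int (a_coord t l i))"


section \<open>Points indexed by \<open>\<int>/t\<int>\<close>\<close>

text \<open>A point of $\mathbb{R}^t$ with coordinates indexed by $\mathbb{Z}/t\mathbb{Z}$ is a
  \<open>t\<close>-periodic function on the integers; sums over $\mathbb{Z}/t\mathbb{Z}$ run over the
  representatives \<open>{0..<int t}\<close>.\<close>

definition cyc :: "nat \<Rightarrow> (int \<Rightarrow> real) set" where
  "cyc t = {x. \<forall>i. x (i + int t) = x i}"

definition a_hyperplane :: "nat \<Rightarrow> (int \<Rightarrow> real) set" where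
  "a_hyperplane t = {a \<in> cyc t. (\<Sum>i\<in>{0..<int t}. a i) = real (t choose 2)}"

definition z_hyperplane :: "nat \<Rightarrow> nat \<Rightarrow> (int \<Rightarrow> real) set" where
  "z_hyperplane s t = {z \<in> cyc t. (\<Sum>j\<in>{0..<int t}. z j) = real s}"

definition a_simplex :: "nat \<Rightarrow> nat \<Rightarrow> (int \<Rightarrow> real) set" where
  "a_simplex s t = {a \<in> a_hyperplane t. \<forall>i. a i \<ge> a (i + int s) - real s}"

definition z_simplex :: "nat \<Rightarrow> nat \<Rightarrow> (int \<Rightarrow> real) set" where
  "z_simplex s t = {z \<in> z_hyperplane s t. \<forall>j. z j \<ge> 0}"

definition a_lattice :: "nat \<Rightarrow> (int \<Rightarrow> real) set" where
  "a_lattice t = {a \<in> a_hyperplane t. \<forall>i. a i \<in> \<int> \<and> [a i = of_int i] (rmod real t)}"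

definition z_lattice :: "nat \<Rightarrow> nat \<Rightarrow> (int \<Rightarrow> real) set" where
  "z_lattice s t = {z \<in> z_hyperplane s t. (\<forall>j. z j \<in> \<int>) \<and>
     [(\<Sum>i\<in>{0..<int t}. of_int i * z i) = 0] (rmod real t)}"

text \<open>The sets $A_t(s)$ and $\mathrm{TD}_t(s)$.\<close>

definition A_set :: "nat \<Rightarrow> nat \<Rightarrow> (int \<Rightarrow> real) set" where
  "A_set s t = a_lattice t \<inter> a_simplex s t"

definition TD_set :: "nat \<Rightarrow> nat \<Rightarrow> (int \<Rightarrow> real) set" where
  "TD_set s t = z_lattice s t \<inter> z_simplex s t"

text \<open>The integer division is exact when \<open>s\<close> and \<open>t\<close> are coprime.\<close>

definition shift :: "nat \<Rightarrow> nat \<Rightarrow> int" where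
  "shift s t = (int s + 1) * (int t - 1) div 2"

definition z_map :: "nat \<Rightarrow> nat \<Rightarrow> (int \<Rightarrow> real) \<Rightarrow> int \<Rightarrow> real" where
  "z_map s t a = (\<lambda>j. (a (int s * j + shift s t)
       - (a (int s * (j + 1) + shift s t) - real s)) / real t)"


section \<open>Affine notions for real-valued functions\<close>

text \<open>The function type is not an instance of \<open>real_vector\<close>, so affine maps and simplices are
  spelled out pointwise.\<close>

definition affine_map_on :: "(int \<Rightarrow> real) set \<Rightarrow> ((int \<Rightarrow> real) \<Rightarrow> int \<Rightarrow> real) \<Rightarrow> bool" where
  "affine_map_on H f \<longleftrightarrow> (\<forall>x\<in>H. \<forall>y\<in>H. \<forall>u v. u + v = 1 \<longrightarrow>
     f (\<lambda>i. u * x i + v * y i) = (\<lambda>j. u * f x j + v * f y j))"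

text \<open>\<open>is_simplex n S\<close>: \<open>S\<close> is the convex hull of \<open>n\<close> affinely independent points
  \<open>v 0, \<dots>, v (n - 1)\<close>.\<close>

definition is_simplex :: "nat \<Rightarrow> (int \<Rightarrow> real) set \<Rightarrow> bool" where
  "is_simplex n S \<longleftrightarrow> (\<exists>v :: nat \<Rightarrow> int \<Rightarrow> real.
     (\<forall>w. (\<Sum>p<n. w p) = 0 \<and> (\<forall>i. (\<Sum>p<n. w p * v p i) = 0) \<longrightarrow> (\<forall>p<n. w p = 0)) \<and>
     S = {\<lambda>i. \<Sum>p<n. u p * v p i | u. (\<forall>p<n. u p \<ge> 0) \<and> (\<Sum>p<n. u p) = 1})"

end

theory Submission
  imports Defs
begin

text \<open>
  A hook of length \<open>h\<close> is a pair of an element \<open>x\<close> of the beta-set \<open>B\<close> with \<open>x - h \<notin> B\<close>, because the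
  complement of \<open>B\<close> consists of the numbers \<open>c - 1 - \<lambda>'\<^sub>c\<close> with \<open>c \<ge> 1\<close>. So the beta-set of a \<open>t\<close>-core is
  \<open>{x. x < a x}\<close> for the periodic function \<open>a\<close> of its coordinates \<open>a\<^sub>t\<^sub>,\<^sub>i\<close>. Conversely such a set is a
  beta-set iff as many nonnegative numbers lie in it as negative ones lie outside of it, and counting
  residue class by residue class turns this into \<open>\<Sum>a = t choose 2\<close>. Closure under subtracting \<open>s\<close> is
  \<open>a i \<ge> a (i + s) - s\<close>.

  Reading \<open>a\<close> along \<open>j \<mapsto> s j + k\<close> makes the change of variables a first difference on \<open>\<int>/t\<int>\<close>,
  which is inverted by summation by parts with the weights \<open>(t - 1)/2 - j\<close>. The inverse formula at
  \<open>l = 0\<close> reads \<open>a\<^sub>t\<^sub>,\<^sub>k = k - \<Sum>j z\<^sub>t\<^sub>,\<^sub>j\<close>, so the congruence on \<open>z\<close> says that \<open>a\<^sub>t\<^sub>,\<^sub>k\<close> is congruent to \<open>k\<close>, and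
  integrality of \<open>z\<close> propagates this to all other indices.
\<close>

section \<open>Beta-sets and hooks\<close>

lemma partitions_antimono:
  assumes "l \<in> partitions" "1 \<le> i" "i \<le> j"
  shows "l j \<le> l i"
  using assms(3)
proof (induction j rule: dec_induct)
  case (step n)
  have "l (n + 1) \<le> l n" using assms step unfolding partitions_def by auto
  with step show ?case by simp
qed simp

lemma partitions_eventually_zero:
  assumes "l \<in> partitions"
  obtains N where "\<And>i. i > N \<Longrightarrow> l i = 0"
proof -
  have "(\<lambda>i. real (l i)) \<longlonglongrightarrow> 0"
    using assms summable_LIMSEQ_zero unfolding partitions_def by blast
  then have "eventually (\<lambda>i. real (l i) < 1) sequentially"
    by (rule order_tendstoD) simp
  then obtain N where "\<And>i. i \<ge> N \<Longrightarrow> real (l i) < 1"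
    unfolding eventually_sequentially by blast
  then show ?thesis using that[of N] by fastforce
qed

lemma beta_strict_decreasing:
  assumes "l \<in> partitions" "1 \<le> i" "i < j"
  shows "int (l j) - int j < int (l i) - int i"
  using partitions_antimono[OF assms(1,2), of j] assms(3) by linarith

lemma beta_set_lower:
  assumes "\<And>i. i > N \<Longrightarrow> l i = 0" "x < - int N"
  shows "x \<in> beta_set l"
proof -
  have "l (nat (- x)) = 0" using assms by auto
  then show ?thesis using assms(2) unfolding beta_set_def
    by (intro CollectI exI[of _ "nat (- x)"]) auto
qed

lemma beta_set_upper:
  assumes "l \<in> partitions" "x \<in> beta_set l"
  shows "x < int (l 1)"
proof -
  obtain i where i: "i \<ge> 1" "x = int (l i) - int i" using assms(2) unfolding beta_set_def by auto
  then show ?thesis using partitions_antimono[OF assms(1), of 1 i] by linarith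
qed

text \<open>Index \<open>i \<le> N\<close> gives an element at least \<open>- N\<close>, while every
  later index gives \<open>- i < - N\<close>, so the window sees exactly the first \<open>N\<close>
  indices. This count is what distinguishes beta-sets of partitions from other sets that contain all
  sufficiently small integers and are bounded above.\<close>

lemma card_beta_set_window:
  assumes l: "l \<in> partitions" and N: "\<And>i. i > N \<Longrightarrow> l i = 0"
  shows "card {x \<in> beta_set l. - int N \<le> x} = N"
proof -
  have "{x \<in> beta_set l. - int N \<le> x} = (\<lambda>i. int (l i) - int i) ` {1..N}"
  proof (intro set_eqI iffI)
    fix x assume "x \<in> {x \<in> beta_set l. - int N \<le> x}"
    then obtain i where i: "i \<ge> 1" "x = int (l i) - int i" "- int N \<le> x"
      unfolding beta_set_def by auto
    then have "i \<le> N" using N[of i] by (cases "i \<le> N") auto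
    with i show "x \<in> (\<lambda>i. int (l i) - int i) ` {1..N}" by auto
  qed (auto simp: beta_set_def)
  moreover have "inj_on (\<lambda>i. int (l i) - int i) {1..N}"
    by (rule linorder_inj_onI')
       (use beta_strict_decreasing[OF l] in \<open>fastforce\<close>)
  ultimately show ?thesis by (simp add: card_image)
qed

text \<open>Strong induction on the index. If all earlier parts agree, the \<open>i\<close>-th
  element of one beta-set occurs in the other at an index \<open>k\<close>. Here
  \<open>k < i\<close> is impossible, since those positions hold strictly larger elements, and
  \<open>k \<ge> i\<close> gives one inequality. The other follows by exchanging the two partitions,
  so \<open>step\<close> is stated for arbitrary ones.\<close>

lemma beta_set_inject:
  assumes l: "l \<in> partitions" and m: "m \<in> partitions" and eq: "beta_set l = beta_set m"
  shows "l = m"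
proof -
  have step: "l i \<le> m i" if l: "l \<in> partitions" and m: "m \<in> partitions"
    and sub: "beta_set l \<subseteq> beta_set m" and i: "i \<ge> 1"
    and IH: "\<And>j. 1 \<le> j \<Longrightarrow> j < i \<Longrightarrow> l j = m j" for l m i
  proof -
    have "int (l i) - int i \<in> beta_set m" using sub i unfolding beta_set_def by auto
    then obtain k where k: "k \<ge> 1" "int (l i) - int i = int (m k) - int k"
      unfolding beta_set_def by auto
    have "k \<ge> i"
    proof (rule ccontr)
      assume "\<not> k \<ge> i"
      then show False using k IH[of k] beta_strict_decreasing[OF l, of k i] by simp
    qed
    then show ?thesis using partitions_antimono[OF m i, of k] k by linarith
  qed
  have "l i = m i" if "i \<ge> 1" for i
    using that
  proof (induction i rule: less_induct)
    case (less i)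
    then show ?case using step[OF l m, of i] step[OF m l, of i] eq by (simp add: antisym)
  qed
  moreover have "l 0 = m 0" using l m unfolding partitions_def by simp
  ultimately have "l i = m i" for i by (cases "i = 0") auto
  then show ?thesis by (rule ext)
qed

text \<open>Converse of \<open>card_beta_set_window\<close>: reading the \<open>N\<close> window
  elements from the largest downwards yields the first \<open>N\<close> parts, and zero parts
  account for everything below the window.\<close>

lemma partition_of_beta_set:
  fixes B :: "int set" and N :: nat
  assumes low: "\<And>x. x < - int N \<Longrightarrow> x \<in> B"
    and fin: "finite {x \<in> B. - int N \<le> x}" and card: "card {x \<in> B. - int N \<le> x} = N"
  obtains l where "l \<in> partitions" "beta_set l = B"
proof -
  define F where "F = {x \<in> B. - int N \<le> x}"
  define ys where "ys = sorted_list_of_set F"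
  have set: "set ys = F" and len: "length ys = N" and sorted: "sorted_wrt (<) ys"
    using fin card unfolding ys_def F_def by (auto simp: sorted_list_of_set.length_sorted_key_list_of_set)
  \<comment> \<open>Strictly increasing integers that start at \<open>- N\<close> or above. This
    bound makes the parts nonnegative, so that \<open>nat\<close> in the definition of
    \<open>l\<close> loses nothing.\<close>
  have lower: "ys ! j \<ge> int j - int N" if "j < N" for j
    using that
  proof (induction j)
    case 0
    then have "ys ! 0 \<in> F" using set len by (metis nth_mem)
    then show ?case unfolding F_def by simp
  next
    case (Suc j)
    then have "ys ! j < ys ! Suc j" using sorted len by (simp add: sorted_wrt_nth_less)
    then show ?case using Suc by simp
  qed
  \<comment> \<open>The \<open>i\<close>-th largest window element is \<open>ys ! (N - i)\<close>,
    and it has to equal \<open>l i - i\<close>.\<close>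
  define l where "l i = (if 1 \<le> i \<and> i \<le> N then nat (ys ! (N - i) + int i) else 0)" for i
  have l: "int (l i) = ys ! (N - i) + int i" if "1 \<le> i" "i \<le> N" for i
    using lower[of "N - i"] that unfolding l_def by auto
  have "l (i + 1) \<le> l i" if "i \<ge> 1" for i
  proof (cases "i + 1 \<le> N")
    case True
    then have "ys ! (N - (i + 1)) < ys ! (N - i)"
      using sorted_wrt_nth_less[OF sorted, of "N - (i + 1)" "N - i"] len that True by simp
    then show ?thesis using l[of i] l[of "i + 1"] True that by linarith
  qed (simp add: l_def)
  moreover have "summable (\<lambda>i. real (l i))"
    by (rule summable_finite[of "{..N}"]) (auto simp: l_def)
  ultimately have "l \<in> partitions" unfolding partitions_def by (auto simp: l_def)
  moreover have "beta_set l = B"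
  proof (intro set_eqI iffI)
    fix x assume "x \<in> beta_set l"
    then obtain i where i: "i \<ge> 1" "x = int (l i) - int i" unfolding beta_set_def by auto
    show "x \<in> B"
    proof (cases "i \<le> N")
      case True
      then have "x \<in> set ys" using i l[of i] len by simp
      then show ?thesis using set F_def by auto
    next
      case False
      then show ?thesis using i low unfolding l_def by auto
    qed
  next
    fix x assume x: "x \<in> B"
    show "x \<in> beta_set l"
    proof (cases "x < - int N")
      case True
      then show ?thesis by (rule beta_set_lower[rotated]) (simp add: l_def)
    next
      case False
      then have "x \<in> set ys" using x set F_def by auto
      then obtain j where "j < N" "x = ys ! j" using len by (auto simp: in_set_conv_nth)
      then have "N - j \<ge> 1" "x = int (l (N - j)) - int (N - j)" using l[of "N - j"] by auto
      then show ?thesis unfolding beta_set_def by blast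
    qed
  qed
  ultimately show ?thesis using that by blast
qed

section \<open>Conjugates, gaps of the beta-set and hooks\<close>

lemma le_part_iff_le_conjugate:
  assumes l: "l \<in> partitions" and "r \<ge> 1" "c \<ge> 1"
  shows "c \<le> l r \<longleftrightarrow> r \<le> conjugate l c"
proof -
  obtain N where N: "\<And>i. i > N \<Longrightarrow> l i = 0" using partitions_eventually_zero[OF l] by blast
  \<comment> \<open>The rows of length at least \<open>c\<close>. As \<open>l\<close> is weakly
    decreasing they form an initial segment: \<open>R\<close> contains \<open>{1..r}\<close> if row
    \<open>r\<close> belongs to it and lies inside \<open>{1..<r}\<close> otherwise, so comparing
    cardinalities decides both directions.\<close>
  define R where "R = {i. i \<ge> 1 \<and> c \<le> l i}"
  have "\<not> N < i" if "c \<le> l i" for i using N[of i] that assms(3) by auto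
  then have "R \<subseteq> {..N}" unfolding R_def by (auto simp: not_less)
  then have fin: "finite R" by (rule finite_subset) simp
  have conj: "conjugate l c = card R" using assms(3) unfolding conjugate_def R_def by simp
  show ?thesis
  proof
    assume "c \<le> l r"
    then have "c \<le> l i" if "1 \<le> i" "i \<le> r" for i
      using partitions_antimono[OF l that] by linarith
    then have "{1..r} \<subseteq> R" unfolding R_def by auto
    from card_mono[OF fin this] show "r \<le> conjugate l c" using conj by simp
  next
    assume le: "r \<le> conjugate l c"
    show "c \<le> l r"
    proof (rule ccontr)
      assume "\<not> c \<le> l r"
      then have "i < r" if "c \<le> l i" for i
        using partitions_antimono[OF l assms(2), of i] that by (cases "i < r") auto
      then have "R \<subseteq> {1..<r}" unfolding R_def by auto
      then have "card R \<le> r - 1" using card_mono[of "{1..<r}" R] by simp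
      then show False using le conj assms(2) by simp
    qed
  qed
qed

text \<open>The gaps correspond to the columns. For a gap \<open>y\<close>, let \<open>n\<close> be
  the first index at which the beta-sequence is below \<open>y\<close>. Then exactly
  \<open>n - 1\<close> rows reach column \<open>c = y + n\<close>. Conversely, a beta-element equal
  to the number of a column contradicts \<open>le_part_iff_le_conjugate\<close>, whether or not its
  row reaches that column.\<close>

lemma not_in_beta_set_iff:
  assumes l: "l \<in> partitions"
  shows "y \<notin> beta_set l \<longleftrightarrow> (\<exists>c\<ge>1. y = int c - 1 - int (conjugate l c))"
proof
  assume y: "y \<notin> beta_set l"
  obtain N where N: "\<And>i. i > N \<Longrightarrow> l i = 0" using partitions_eventually_zero[OF l] by blast
  define P where "P n \<longleftrightarrow> n \<ge> 1 \<and> int (l n) - int n < y" for n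
  \<comment> \<open>Beyond \<open>N\<close> the parts vanish, and this index is large enough for its
    negative to be below \<open>y\<close>.\<close>
  have "P (N + nat (\<bar>y\<bar>) + 1)" using N unfolding P_def by auto
  then have P: "P (Least P)" by (rule LeastI)
  have least: "\<not> P i" if "i < Least P" for i using that by (rule not_less_Least)
  define n where "n = Least P"
  have n: "n \<ge> 1" "int (l n) < y + int n" using P unfolding P_def n_def by auto
  define c where "c = nat (y + int n)"
  have c: "int c = y + int n" "c \<ge> 1" using n unfolding c_def by auto
  have "c \<le> l i \<longleftrightarrow> i \<le> n - 1" if "i \<ge> 1" for i
  proof (cases "i < n")
    case True
    then have n1: "n - 1 \<ge> 1" using that by simp
    then have "int (l (n - 1)) - int (n - 1) \<in> beta_set l" unfolding beta_set_def by blast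
    \<comment> \<open>Here the gap is used: minimality of \<open>n\<close> only gives
      \<open>\<ge> y\<close>, and the strict inequality is what makes row \<open>n - 1\<close> reach
      column \<open>c\<close>.\<close>
    then have "int (l (n - 1)) - int (n - 1) \<noteq> y" using y by auto
    moreover have "\<not> P (n - 1)" using n(1) by (intro least) (simp add: n_def[symmetric])
    ultimately have "int (l (n - 1)) - int (n - 1) > y" using n1 unfolding P_def by linarith
    then have "c \<le> l (n - 1)" using c n by linarith
    then show ?thesis using partitions_antimono[OF l that, of "n - 1"] True by auto
  next
    case False
    then show ?thesis using partitions_antimono[OF l n(1), of i] n c by auto
  qed
  then have "i \<le> conjugate l c \<longleftrightarrow> i \<le> n - 1" if "i \<ge> 1" for i
    using le_part_iff_le_conjugate[OF l that c(2)] that by simp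
  from this[of "conjugate l c"] this[of "n - 1"] have "conjugate l c = n - 1"
    by linarith
  then show "\<exists>c\<ge>1. y = int c - 1 - int (conjugate l c)"
    using c n by (intro exI[of _ c]) auto
next
  assume "\<exists>c\<ge>1. y = int c - 1 - int (conjugate l c)"
  then obtain c where c: "c \<ge> 1" "y = int c - 1 - int (conjugate l c)" by blast
  show "y \<notin> beta_set l"
  proof
    assume "y \<in> beta_set l"
    then obtain i where i: "i \<ge> 1" "y = int (l i) - int i" unfolding beta_set_def by auto
    show False using le_part_iff_le_conjugate[OF l i(1) c(1)] i c by linarith
  qed
qed

text \<open>The hook length at \<open>(r, c)\<close> is the difference of the beta-element of row
  \<open>r\<close> and the gap of column \<open>c\<close>, so hooks of length \<open>t\<close> are
  the pairs of an element and a gap \<open>t\<close> below it.\<close>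

lemma cores_iff_beta_set:
  assumes "t \<ge> 1"
  shows "l \<in> cores t \<longleftrightarrow> l \<in> partitions \<and> (\<forall>x\<in>beta_set l. x - int t \<in> beta_set l)"
proof (cases "l \<in> partitions")
  case l: True
  have "(\<exists>(r, c)\<in>young_diagram l. hook_length l r c = int t) \<longleftrightarrow>
    (\<exists>x\<in>beta_set l. x - int t \<notin> beta_set l)"
  proof
    assume "\<exists>(r, c)\<in>young_diagram l. hook_length l r c = int t"
    then obtain r c where rc: "r \<ge> 1" "c \<ge> 1" "hook_length l r c = int t"
      unfolding young_diagram_def by auto
    have "int (l r) - int r \<in> beta_set l" using rc unfolding beta_set_def by blast
    moreover have "int (l r) - int r - int t = int c - 1 - int (conjugate l c)"
      using rc unfolding hook_length_def by simp
    ultimately show "\<exists>x\<in>beta_set l. x - int t \<notin> beta_set l"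
      using not_in_beta_set_iff[OF l] rc by blast
  next
    assume "\<exists>x\<in>beta_set l. x - int t \<notin> beta_set l"
    then obtain r c where rc: "r \<ge> 1" "c \<ge> 1"
      and eq: "int (l r) - int r - int t = int c - 1 - int (conjugate l c)"
      unfolding not_in_beta_set_iff[OF l] by (auto simp: beta_set_def)
    \<comment> \<open>A row and a column that do not meet in the diagram have negative arm and leg,
      so the hook expression is negative there and cannot equal \<open>t\<close>.\<close>
    have "c \<le> l r" using le_part_iff_le_conjugate[OF l rc] eq by linarith
    then show "\<exists>(r, c)\<in>young_diagram l. hook_length l r c = int t"
      using rc eq unfolding young_diagram_def hook_length_def
      by (intro bexI[of _ "(r, c)"]) auto
  qed
  then show ?thesis using l unfolding cores_def by auto
qed (simp add: cores_def)


section \<open>Sums over $\mathbb{Z}/t\mathbb{Z}$\<close>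

lemma sum_int_lessThan: "(\<Sum>i\<in>{0..<int n}. f i) = (\<Sum>i<n. f (int i))"
  by (rule sum.reindex_bij_witness[of _ int nat]) auto

lemma real_choose_two: "real (n choose 2) = real n * (real n - 1) / 2"
  by (induction n) (auto simp: numeral_2_eq_2 field_simps)

lemma sum_int_eq_choose_two: "(\<Sum>i\<in>{0..<int n}. i) = int (n choose 2)"
  unfolding sum_int_lessThan by (induction n) (auto simp: numeral_2_eq_2)

lemma sum_of_int_eq_choose_two:
  "(\<Sum>j\<in>{0..<int n}. real_of_int j) = real n * (real n - 1) / 2"
  unfolding of_int_sum[symmetric] sum_int_eq_choose_two
  by (simp add: real_choose_two)

lemma coprime_affine_inverse:
  fixes s t k :: int
  assumes "coprime s t"
  obtains j where "[s * j + k = i] (mod t)"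
proof -
  obtain x where "[s * x = 1] (mod t)" using cong_solve_coprime_int[OF assms] by blast
  then have "[s * x * (i - k) + k = 1 * (i - k) + k] (mod t)"
    by (intro cong_add cong_mult) auto
  then show ?thesis using that[of "x * (i - k)"] by (simp add: mult.assoc)
qed

lemma cyc_add: "x \<in> cyc t \<Longrightarrow> x (i + int t) = x i"
  unfolding cyc_def by simp

lemma cyc_cong:
  assumes x: "x \<in> cyc t" and "[i = j] (mod int t)"
  shows "x i = x j"
proof -
  have nat: "x (i + int n * int t) = x i" for i n
  proof (induction n)
    case (Suc n)
    have "x (i + int (Suc n) * int t) = x ((i + int n * int t) + int t)"
      by (simp add: algebra_simps)
    with Suc show ?case using x unfolding cyc_def by simp
  qed simp
  obtain m where m: "j = i + int t * m" using assms(2) by (auto simp: cong_iff_lin)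
  show ?thesis
  proof (cases "m \<ge> 0")
    case True
    then show ?thesis using nat[of i "nat m"] m by (simp add: mult.commute)
  next
    case False
    then show ?thesis using nat[of j "nat (- m)"] m by (simp add: mult.commute)
  qed
qed

text \<open>Multiplication by a unit followed by a translation permutes the residue classes.\<close>

lemma sum_cyc_affine:
  assumes x: "x \<in> cyc t" and "coprime (int s) (int t)" and t: "t \<ge> 1"
  shows "(\<Sum>j\<in>{0..<int t}. x (int s * j + k)) = (\<Sum>j\<in>{0..<int t}. x j)"
proof -
  let ?f = "\<lambda>j. (int s * j + k) mod int t"
  have inj: "inj_on ?f {0..<int t}"
  proof (rule inj_onI)
    fix i j assume ij: "i \<in> {0..<int t}" "j \<in> {0..<int t}" "?f i = ?f j"
    then have "[int s * i + k = int s * j + k] (mod int t)" unfolding cong_def by simp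
    then have "[int s * i = int s * j] (mod int t)" by (simp add: cong_add_rcancel)
    then have "[i = j] (mod int t)" using assms(2) by (simp add: cong_mult_lcancel coprime_commute)
    then show "i = j" using ij by (simp add: cong_def)
  qed
  have "?f ` {0..<int t} = {0..<int t}"
    by (rule endo_inj_surj[OF _ _ inj]) (use t in auto)
  then have "(\<Sum>j\<in>{0..<int t}. x j) = (\<Sum>j\<in>{0..<int t}. x (?f j))"
    using sum.reindex[OF inj, of x] by simp
  also have "\<dots> = (\<Sum>j\<in>{0..<int t}. x (int s * j + k))"
    by (intro sum.cong refl cyc_cong[OF x]) (simp add: cong_def)
  finally show ?thesis by simp
qed

lemma sum_cyc_shift:
  assumes "x \<in> cyc t" "t \<ge> 1"
  shows "(\<Sum>j\<in>{0..<int t}. x (j + k)) = (\<Sum>j\<in>{0..<int t}. x j)"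
  using sum_cyc_affine[of x t 1 k] assms by simp

text \<open>Summation by parts. Periodicity merges the two boundary terms, whose weights
  \<open>c + 1\<close> and \<open>c - t + 1\<close> differ by \<open>t\<close>.\<close>

lemma sum_centred_differences:
  assumes x: "x \<in> cyc t" and t: "t \<ge> 1"
  shows "(\<Sum>j\<in>{0..<int t}. ((real t - 1) / 2 - of_int j) * (x (j + l) - x (j + l + 1)))
    = real t * x l - (\<Sum>j\<in>{0..<int t}. x j)"
proof -
  have "(\<Sum>i<n. (c - real i) * (x (int i + l) - x (int i + l + 1)))
    = (c + 1) * x l - (c - real n + 1) * x (int n + l) - (\<Sum>i<n. x (int i + l))" for n c
    by (induction n) (auto simp: algebra_simps)
  from this[where n = t and c = "(real t - 1) / 2"]
  have "(\<Sum>j\<in>{0..<int t}. ((real t - 1) / 2 - of_int j) * (x (j + l) - x (j + l + 1)))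
    = ((real t - 1) / 2 + 1) * x l - ((real t - 1) / 2 - real t + 1) * x (int t + l)
      - (\<Sum>j\<in>{0..<int t}. x (j + l))"
    unfolding sum_int_lessThan by simp
  moreover have "x (int t + l) = x l" using cyc_add[OF x, of l] by (simp add: add.commute)
  ultimately show ?thesis using sum_cyc_shift[OF x t] by (simp add: field_simps)
qed

text \<open>Centring makes the weights annihilate constants, so the summand \<open>s\<close> in the
  change of variables drops out of the inverse formula.\<close>

lemma sum_centred_coeffs: "(\<Sum>j\<in>{0..<int t}. (real t - 1) / 2 - of_int j) = 0"
  by (simp add: sum_subtractf sum_of_int_eq_choose_two)


section \<open>The change of variables\<close>

locale coprime_pair =
  fixes s t :: nat
  assumes s: "s \<ge> 1" and t: "t \<ge> 1" and coprime: "coprime s t"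
begin

lemma coprime_int: "coprime (int s) (int t)"
  using coprime by simp

text \<open>Coprime numbers are not both even, so one of \<open>s + 1\<close> and
  \<open>t - 1\<close> is even.\<close>

lemma shift_exact: "real_of_int (shift s t) = (real s + 1) * (real t - 1) / 2"
proof -
  have "odd s \<or> odd t" using coprime coprime_common_divisor[of s t 2] by auto
  then have "even ((int s + 1) * (int t - 1))" by auto
  then have "2 * shift s t = (int s + 1) * (int t - 1)" unfolding shift_def by simp
  from arg_cong[OF this, of real_of_int] show ?thesis by simp
qed

lemma shift_surj:
  obtains j where "[int s * j + shift s t = i] (mod int t)"
  using coprime_affine_inverse[OF coprime_int] by blast

text \<open>In this ordering the classes of \<open>i\<close> and \<open>i + s\<close> become
  neighbours.\<close>

definition b_coords :: "(int \<Rightarrow> real) \<Rightarrow> int \<Rightarrow> real" where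
  "b_coords a j = a (int s * j + shift s t)"

lemma z_map_eq: "z_map s t a j = (b_coords a j - b_coords a (j + 1) + real s) / real t"
  unfolding z_map_def b_coords_def by simp

lemma b_coords_cyc:
  assumes "a \<in> cyc t" shows "b_coords a \<in> cyc t"
  unfolding cyc_def b_coords_def
  by (intro CollectI allI cyc_cong[OF assms]) (simp add: cong_iff_dvd_diff algebra_simps)

lemma sum_b_coords:
  assumes "a \<in> cyc t"
  shows "(\<Sum>j\<in>{0..<int t}. b_coords a j) = (\<Sum>j\<in>{0..<int t}. a j)"
  unfolding b_coords_def using sum_cyc_affine[OF assms coprime_int t] .

lemma cyc_eqI_b_coords:
  assumes "a \<in> cyc t" "a' \<in> cyc t" "b_coords a = b_coords a'"
  shows "a = a'"
proof
  fix i
  obtain j where "[int s * j + shift s t = i] (mod int t)" using shift_surj .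
  then show "a i = a' i"
    using cyc_cong[OF assms(1)] cyc_cong[OF assms(2)] fun_cong[OF assms(3), of j]
    unfolding b_coords_def by metis
qed

text \<open>The candidate inverse in the reordered coordinates. The constant
  \<open>(t - 1) / 2\<close> is the mean of the \<open>a\<close>-coordinates on the
  hyperplane.\<close>

definition b_of_z :: "(int \<Rightarrow> real) \<Rightarrow> int \<Rightarrow> real" where
  "b_of_z z l = (real t - 1) / 2
     + (\<Sum>j\<in>{0..<int t}. ((real t - 1) / 2 - of_int j) * z (j + l))"

lemma z_map_hyperplane:
  assumes "a \<in> a_hyperplane t"
  shows "z_map s t a \<in> z_hyperplane s t"
proof -
  have a: "a \<in> cyc t" using assms unfolding a_hyperplane_def by simp
  have "z_map s t a \<in> cyc t"
    using cyc_add[OF b_coords_cyc[OF a]] cyc_add[OF b_coords_cyc[OF a], of "i + 1" for i]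
    unfolding cyc_def z_map_eq by (simp add: ac_simps)
  moreover have "(\<Sum>j\<in>{0..<int t}. z_map s t a j) = real s"
    using sum_cyc_shift[OF b_coords_cyc[OF a] t, of 1] t
    by (simp add: z_map_eq sum.distrib sum_subtractf flip: sum_divide_distrib)
  ultimately show ?thesis unfolding z_hyperplane_def by simp
qed

text \<open>After multiplication by \<open>t\<close> the centred weights kill the constant
  \<open>s\<close>, and summation by parts leaves \<open>t\<close> times the coordinate minus the
  prescribed sum. Injectivity of the change of variables follows from this.\<close>

lemma b_coords_eq_b_of_z:
  assumes "a \<in> a_hyperplane t"
  shows "b_coords a = b_of_z (z_map s t a)"
proof
  fix l
  let ?c = "\<lambda>j. (real t - 1) / 2 - real_of_int j" and ?b = "b_coords a"
  have a: "a \<in> cyc t" using assms unfolding a_hyperplane_def by simp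
  have "real t * (\<Sum>j\<in>{0..<int t}. ?c j * z_map s t a (j + l))
    = (\<Sum>j\<in>{0..<int t}. ?c j * (real t * z_map s t a (j + l)))"
    by (simp add: sum_distrib_left mult.left_commute)
  also have "\<dots> = (\<Sum>j\<in>{0..<int t}. ?c j * (?b (j + l) - ?b (j + l + 1)) + ?c j * real s)"
    using t by (intro sum.cong refl) (simp add: z_map_eq distrib_left[symmetric])
  also have "\<dots> = (\<Sum>j\<in>{0..<int t}. ?c j * (?b (j + l) - ?b (j + l + 1)))
      + (\<Sum>j\<in>{0..<int t}. ?c j) * real s"
    by (simp only: sum.distrib sum_distrib_right)
  also have "\<dots> = real t * ?b l - real t * (real t - 1) / 2"
    using sum_centred_differences[OF b_coords_cyc[OF a] t] sum_b_coords[OF a] assms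
    unfolding sum_centred_coeffs a_hyperplane_def by (simp add: real_choose_two)
  also have "\<dots> = real t * (?b l - (real t - 1) / 2)" by (simp add: right_diff_distrib)
  finally show "?b l = b_of_z (z_map s t a) l"
    using t unfolding b_of_z_def by simp
qed

lemma b_of_z_cyc:
  assumes "z \<in> cyc t" shows "b_of_z z \<in> cyc t"
  using cyc_add[OF assms, of "j + l" for j l] unfolding cyc_def b_of_z_def by (simp add: ac_simps)

text \<open>Summation by parts once more, now applied to \<open>z\<close> itself; the total of
  \<open>z\<close> supplies the \<open>s\<close>.\<close>

lemma b_of_z_diff:
  assumes "z \<in> z_hyperplane s t"
  shows "b_of_z z l - b_of_z z (l + 1) + real s = real t * z l"
proof -
  have z: "z \<in> cyc t" "(\<Sum>j\<in>{0..<int t}. z j) = real s"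
    using assms unfolding z_hyperplane_def by auto
  have "b_of_z z l - b_of_z z (l + 1)
    = (\<Sum>j\<in>{0..<int t}. ((real t - 1) / 2 - of_int j) * (z (j + l) - z (j + l + 1)))"
    unfolding b_of_z_def by (simp add: sum_subtractf[symmetric] algebra_simps)
  then show ?thesis using sum_centred_differences[OF z(1) t] z(2) by simp
qed

text \<open>After exchanging the sums, every inner sum is \<open>s\<close> by periodicity and the
  centred weights cancel, which leaves \<open>t\<close> copies of the mean.\<close>

lemma sum_b_of_z:
  assumes "z \<in> z_hyperplane s t"
  shows "(\<Sum>l\<in>{0..<int t}. b_of_z z l) = real (t choose 2)"
proof -
  have z: "z \<in> cyc t" "(\<Sum>j\<in>{0..<int t}. z j) = real s"
    using assms unfolding z_hyperplane_def by auto
  have "(\<Sum>l\<in>{0..<int t}. \<Sum>j\<in>{0..<int t}. ((real t - 1) / 2 - of_int j) * z (j + l))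
    = (\<Sum>j\<in>{0..<int t}. ((real t - 1) / 2 - of_int j) * (\<Sum>l\<in>{0..<int t}. z (l + j)))"
    by (subst sum.swap) (simp add: sum_distrib_left add.commute)
  also have "\<dots> = 0"
    using sum_cyc_shift[OF z(1) t] z(2) sum_centred_coeffs
    by (simp flip: sum_distrib_right)
  finally show ?thesis unfolding b_of_z_def by (simp add: sum.distrib real_choose_two)
qed

lemma hyperplane_preimage:
  assumes z: "z \<in> z_hyperplane s t"
  obtains a where "a \<in> a_hyperplane t" "z_map s t a = z"
proof -
  obtain u where u: "[int s * u = 1] (mod int t)" using cong_solve_coprime_int[OF coprime_int] by blast
  \<comment> \<open>With \<open>u\<close> inverse to \<open>s\<close> modulo \<open>t\<close>, the
    argument solves \<open>s * j + k = i\<close> for \<open>j\<close> modulo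
    \<open>t\<close>.\<close>
  define a where "a i = b_of_z z ((i - shift s t) * u)" for i
  have cyc: "b_of_z z \<in> cyc t" using b_of_z_cyc z unfolding z_hyperplane_def by simp
  have a: "a \<in> cyc t"
    unfolding a_def cyc_def
    by (intro CollectI allI cyc_cong[OF cyc]) (simp add: cong_iff_dvd_diff algebra_simps)
  have b: "b_coords a = b_of_z z"
  proof
    fix j
    have "[int s * u * j = 1 * j] (mod int t)" using u by (rule cong_scalar_right)
    then show "b_coords a j = b_of_z z j"
      unfolding b_coords_def a_def by (intro cyc_cong[OF cyc]) (simp add: ac_simps)
  qed
  have "a \<in> a_hyperplane t"
    using a sum_b_coords[OF a] sum_b_of_z[OF z] b unfolding a_hyperplane_def by simp
  moreover have "z_map s t a = z"
    unfolding z_map_eq b b_of_z_diff[OF z] using t by auto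
  ultimately show ?thesis using that by blast
qed

lemma z_map_bij: "bij_betw (z_map s t) (a_hyperplane t) (z_hyperplane s t)"
  unfolding bij_betw_def
proof
  show "inj_on (z_map s t) (a_hyperplane t)"
  proof (rule inj_onI)
    fix a a' assume "a \<in> a_hyperplane t" "a' \<in> a_hyperplane t" "z_map s t a = z_map s t a'"
    then show "a = a'"
      using b_coords_eq_b_of_z[of a] b_coords_eq_b_of_z[of a'] cyc_eqI_b_coords[of a a']
      unfolding a_hyperplane_def by simp
  qed
  show "z_map s t ` a_hyperplane t = z_hyperplane s t"
    using z_map_hyperplane hyperplane_preimage by blast
qed

section \<open>The two simplices and their vertices\<close>

lemma z_map_simplex_iff:
  assumes "a \<in> a_hyperplane t"
  shows "z_map s t a \<in> z_simplex s t \<longleftrightarrow> a \<in> a_simplex s t"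
proof -
  have a: "a \<in> cyc t" using assms unfolding a_hyperplane_def by simp
  have "(\<forall>j. z_map s t a j \<ge> 0) \<longleftrightarrow> (\<forall>i. a i \<ge> a (i + int s) - real s)"
  proof
    assume z: "\<forall>j. z_map s t a j \<ge> 0"
    show "\<forall>i. a i \<ge> a (i + int s) - real s"
    proof
      fix i
      \<comment> \<open>The inequality at \<open>i\<close> is \<open>t\<close> times the one for
        \<open>z\<close> at \<open>j\<close>, and by coprimality every class \<open>i\<close> arises
        in this way.\<close>
      obtain j where j: "[int s * j + shift s t = i] (mod int t)" using shift_surj .
      have "a (int s * j + shift s t) = a i" "a (int s * j + shift s t + int s) = a (i + int s)"
        using j by (auto intro!: cyc_cong[OF a] cong_add)
      then show "a i \<ge> a (i + int s) - real s"
        using z[rule_format, of j] t unfolding z_map_def by (simp add: algebra_simps zero_le_divide_iff)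
    qed
  next
    assume "\<forall>i. a i \<ge> a (i + int s) - real s"
    then have "a (int s * j + shift s t) \<ge> a (int s * j + shift s t + int s) - real s" for j by blast
    then show "\<forall>j. z_map s t a j \<ge> 0"
      unfolding z_map_def by (simp add: algebra_simps)
  qed
  then show ?thesis using assms z_map_hyperplane unfolding z_simplex_def a_simplex_def by blast
qed

lemma z_map_simplex_bij: "bij_betw (z_map s t) (a_simplex s t) (z_simplex s t)"
proof -
  have "bij_betw (z_map s t) {a \<in> a_hyperplane t. a \<in> a_simplex s t}
     {z \<in> z_hyperplane s t. z \<in> z_simplex s t}"
    by (rule bij_betw_Collect[OF z_map_bij]) (simp add: z_map_simplex_iff)
  then show ?thesis unfolding a_simplex_def z_simplex_def by (simp add: conj_ac cong: conj_cong)
qed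

lemma affine_z_map: "affine_map_on H (z_map s t)"
  unfolding affine_map_on_def
proof (intro ballI allI impI ext)
  fix x y :: "int \<Rightarrow> real" and u v :: real and j assume "u + v = 1"
  then have v: "v = 1 - u" by simp
  show "z_map s t (\<lambda>i. u * x i + v * y i) j = u * z_map s t x j + v * z_map s t y j"
    unfolding z_map_def v by (simp add: add_divide_distrib diff_divide_distrib algebra_simps)
qed

text \<open>The weights are arbitrary because two cases are needed: sum 1 for convex combinations
  and sum 0 for affine independence. The last term measures the failure of \<open>z_map\<close> to
  be linear.\<close>

lemma z_map_combination:
  fixes n :: nat
  shows
  "z_map s t (\<lambda>i. \<Sum>p<n. w p * v p i) j
    = (\<Sum>p<n. w p * z_map s t (v p) j) + (1 - (\<Sum>p<n. w p)) * real s / real t"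
  unfolding z_map_def
  by (induction n) (auto simp: add_divide_distrib diff_divide_distrib algebra_simps)

lemma z_simplex_simplex: "is_simplex t (z_simplex s t)"
proof -
  \<comment> \<open>The vertices are \<open>s\<close> times the unit vectors of the residue classes,
    so the barycentric coordinates of \<open>z\<close> are its values divided by
    \<open>s\<close>.\<close>
  define v where "v p i = (if i mod int t = int p then real s else 0)" for p :: nat and i
  have comb: "(\<Sum>p<t. w p * v p i) = w (nat (i mod int t)) * real s" for w i
  proof -
    have "(\<Sum>p<t. w p * v p i) = (\<Sum>p<t. if p = nat (i mod int t) then w p * real s else 0)"
      using t by (intro sum.cong) (auto simp: v_def)
    also have "\<dots> = w (nat (i mod int t)) * real s"
      using t by (simp add: nat_less_iff)
    finally show ?thesis .
  qed
  have sum: "(\<Sum>j\<in>{0..<int t}. w (nat (j mod int t)) * real s) = (\<Sum>p<t. w p) * real s" for w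
    unfolding sum_int_lessThan by (simp add: sum_distrib_right)
  have "\<forall>p<t. w p = 0" if w: "\<forall>i. (\<Sum>p<t. w p * v p i) = 0" for w
  proof (intro allI impI)
    fix p assume "p < t"
    then show "w p = 0" using w[rule_format, of "int p"] s unfolding comb by simp
  qed
  moreover have "z_simplex s t
    = {\<lambda>i. \<Sum>p<t. u p * v p i | u. (\<forall>p<t. u p \<ge> 0) \<and> (\<Sum>p<t. u p) = 1}"
  proof (intro set_eqI iffI)
    fix z assume z: "z \<in> z_simplex s t"
    then have cyc: "z \<in> cyc t" unfolding z_simplex_def z_hyperplane_def by simp
    define u where "u p = z (int p) / real s" for p :: nat
    have zu: "z = (\<lambda>i. \<Sum>p<t. u p * v p i)"
    proof
      fix i
      have "z (i mod int t) = z i" by (rule cyc_cong[OF cyc]) simp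
      then show "z i = (\<Sum>p<t. u p * v p i)" unfolding comb u_def using s t by simp
    qed
    have "(\<Sum>p<t. u p) = 1" "\<forall>p<t. u p \<ge> 0"
      using z s unfolding u_def z_simplex_def z_hyperplane_def sum_int_lessThan
      by (auto simp flip: sum_divide_distrib)
    then show "z \<in> {\<lambda>i. \<Sum>p<t. u p * v p i | u. (\<forall>p<t. u p \<ge> 0) \<and> (\<Sum>p<t. u p) = 1}"
      using zu by blast
  next
    fix z assume "z \<in> {\<lambda>i. \<Sum>p<t. u p * v p i | u. (\<forall>p<t. u p \<ge> 0) \<and> (\<Sum>p<t. u p) = 1}"
    then obtain u where u: "z = (\<lambda>i. \<Sum>p<t. u p * v p i)" "\<forall>p<t. u p \<ge> 0" "(\<Sum>p<t. u p) = 1"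
      by blast
    then show "z \<in> z_simplex s t"
      unfolding z_simplex_def z_hyperplane_def cyc_def comb using t sum[of u]
      by (auto simp: nat_less_iff)
  qed
  ultimately show ?thesis unfolding is_simplex_def by blast
qed

text \<open>The vertices of the \<open>z\<close>-simplex are pulled back along the affine bijection,
  which transports both independence and the hull.\<close>

lemma a_simplex_simplex: "is_simplex t (a_simplex s t)"
proof -
  obtain v :: "nat \<Rightarrow> int \<Rightarrow> real" where
    indep: "\<forall>w. (\<Sum>p<t. w p) = 0 \<and> (\<forall>i. (\<Sum>p<t. w p * v p i) = 0) \<longrightarrow> (\<forall>p<t. w p = 0)"
    and hull: "z_simplex s t
      = {\<lambda>i. \<Sum>p<t. u p * v p i | u. (\<forall>p<t. u p \<ge> 0) \<and> (\<Sum>p<t. u p) = 1}"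
    using z_simplex_simplex unfolding is_simplex_def by (elim exE conjE) (rule that)
  have "\<exists>a\<in>a_hyperplane t. z_map s t a = v p" if "p < t" for p
  proof -
    \<comment> \<open>A vertex belongs to its own hull as the combination with a single weight 1;
      this places it in the hyperplane, where preimages exist.\<close>
    have "(\<lambda>i. \<Sum>q<t. (if q = p then 1 else 0) * v q i) \<in> z_simplex s t"
      unfolding hull using that by (intro CollectI exI[of _ "\<lambda>q. if q = p then 1 else 0"]) auto
    moreover have "(\<lambda>i. \<Sum>q<t. (if q = p then 1 else 0) * v q i) = v p"
      using that by (simp add: if_distrib[of "\<lambda>x. x * _"] cong: if_cong)
    ultimately have "v p \<in> z_hyperplane s t" unfolding z_simplex_def by simp
    then show ?thesis using hyperplane_preimage by metis
  qed
  then obtain v' where v': "\<And>p. p < t \<Longrightarrow> v' p \<in> a_hyperplane t"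
      "\<And>p. p < t \<Longrightarrow> z_map s t (v' p) = v p"
    by metis
  have comb: "z_map s t (\<lambda>i. \<Sum>p<t. w p * v' p i)
    = (\<lambda>i. (\<Sum>p<t. w p * v p i) + (1 - (\<Sum>p<t. w p)) * real s / real t)" for w
    unfolding z_map_combination using v'(2) by simp
  have mem: "(\<lambda>i. \<Sum>p<t. u p * v' p i) \<in> a_hyperplane t" if u: "(\<Sum>p<t. u p) = 1" for u
  proof -
    have "(\<Sum>i\<in>{0..<int t}. \<Sum>p<t. u p * v' p i) = (\<Sum>p<t. u p * (\<Sum>i\<in>{0..<int t}. v' p i))"
      by (subst sum.swap) (simp add: sum_distrib_left)
    also have "\<dots> = (\<Sum>p<t. u p * real (t choose 2))"
      using v'(1) unfolding a_hyperplane_def by simp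
    also have "\<dots> = real (t choose 2)" using u by (simp flip: sum_distrib_right)
    finally show ?thesis using v'(1) unfolding a_hyperplane_def cyc_def by simp
  qed
  have "\<forall>p<t. w p = 0" if w: "(\<Sum>p<t. w p) = 0" "\<forall>i. (\<Sum>p<t. w p * v' p i) = 0" for w
  proof -
    \<comment> \<open>The zero function is mapped to the constant \<open>s / t\<close>, which is
      also the correction term for weights of sum 0, so the two cancel.\<close>
    have "z_map s t (\<lambda>i. \<Sum>p<t. w p * v' p i) = (\<lambda>i. real s / real t)"
      using w(2) unfolding z_map_def by simp
    then have "\<forall>i. (\<Sum>p<t. w p * v p i) = 0" unfolding comb using w(1) by (simp add: fun_eq_iff)
    then show ?thesis using indep w(1) by blast
  qed
  moreover have "a_simplex s t
    = {\<lambda>i. \<Sum>p<t. u p * v' p i | u. (\<forall>p<t. u p \<ge> 0) \<and> (\<Sum>p<t. u p) = 1}"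
  proof (intro set_eqI iffI)
    fix a assume a: "a \<in> a_simplex s t"
    then have H: "a \<in> a_hyperplane t" unfolding a_simplex_def by simp
    then have "z_map s t a \<in> z_simplex s t" using z_map_simplex_iff a by blast
    then obtain u where u: "z_map s t a = (\<lambda>i. \<Sum>p<t. u p * v p i)"
        "\<forall>p<t. u p \<ge> 0" "(\<Sum>p<t. u p) = 1"
      unfolding hull by blast
    then have "z_map s t a = z_map s t (\<lambda>i. \<Sum>p<t. u p * v' p i)" unfolding comb by simp
    then have "a = (\<lambda>i. \<Sum>p<t. u p * v' p i)"
      using z_map_bij H mem[OF u(3)] by (auto simp: bij_betw_def dest: inj_onD)
    then show "a \<in> {\<lambda>i. \<Sum>p<t. u p * v' p i | u. (\<forall>p<t. u p \<ge> 0) \<and> (\<Sum>p<t. u p) = 1}"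
      using u by blast
  next
    fix a assume "a \<in> {\<lambda>i. \<Sum>p<t. u p * v' p i | u. (\<forall>p<t. u p \<ge> 0) \<and> (\<Sum>p<t. u p) = 1}"
    then obtain u where u: "a = (\<lambda>i. \<Sum>p<t. u p * v' p i)" "\<forall>p<t. u p \<ge> 0" "(\<Sum>p<t. u p) = 1"
      by blast
    then have "z_map s t a = (\<lambda>i. \<Sum>p<t. u p * v p i)" using comb by simp
    then have "z_map s t a \<in> z_simplex s t" unfolding hull using u by blast
    then show "a \<in> a_simplex s t" using z_map_simplex_iff mem[OF u(3)] u(1) by blast
  qed
  ultimately show ?thesis unfolding is_simplex_def by blast
qed

section \<open>The inverse formula and the lattices\<close>

lemma z_map_inverse:
  assumes "z \<in> z_hyperplane s t"
  shows "the_inv_into (a_hyperplane t) (z_map s t) z (shift s t + l * int s) = b_of_z z l"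
proof -
  obtain a where a: "a \<in> a_hyperplane t" "z_map s t a = z" using hyperplane_preimage[OF assms] .
  then have "the_inv_into (a_hyperplane t) (z_map s t) z = a"
    using the_inv_into_f_f z_map_bij unfolding bij_betw_def by fastforce
  then show ?thesis using fun_cong[OF b_coords_eq_b_of_z[OF a(1)], of l] a(2)
    unfolding b_coords_def by (simp add: ac_simps)
qed

lemma z_map_lattice_iff:
  assumes H: "a \<in> a_hyperplane t"
  shows "z_map s t a \<in> z_lattice s t \<longleftrightarrow> a \<in> a_lattice t"
proof -
  let ?k = "shift s t" and ?b = "b_coords a" and ?z = "z_map s t a"
  let ?J = "\<Sum>i\<in>{0..<int t}. of_int i * ?z i"
  have cyc: "a \<in> cyc t" using H unfolding a_hyperplane_def by simp
  have zH: "?z \<in> z_hyperplane s t" using z_map_hyperplane[OF H] .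
  have diff: "?b j - ?b (j + 1) + real s = real t * ?z j" for j
    unfolding z_map_eq using t by simp
  \<comment> \<open>The total of \<open>z\<close> is \<open>s\<close>, so the constant terms add up
    to \<open>(s + 1) * (t - 1) / 2\<close>, which is the shift.\<close>
  have zero: "?b 0 = of_int ?k - ?J"
  proof -
    have "?b 0 = (real t - 1) / 2 + (real t - 1) / 2 * (\<Sum>i\<in>{0..<int t}. ?z i) - ?J"
      unfolding b_coords_eq_b_of_z[OF H] b_of_z_def
      by (simp add: sum_distrib_left sum_subtractf left_diff_distrib)
    then show ?thesis using zH shift_exact unfolding z_hyperplane_def
      by (simp add: field_simps)
  qed
  have a_iff: "a \<in> a_lattice t \<longleftrightarrow> (\<forall>j. \<exists>m::int. ?b j = of_int (int s * j + ?k + int t * m))"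
  proof
    assume a: "a \<in> a_lattice t"
    show "\<forall>j. \<exists>m::int. ?b j = of_int (int s * j + ?k + int t * m)"
    proof
      fix j
      have "[of_int (int s * j + ?k) = ?b j] (rmod real t)"
        using a unfolding a_lattice_def b_coords_def by (blast intro: rcong_sym)
      then show "\<exists>m::int. ?b j = of_int (int s * j + ?k + int t * m)"
        unfolding rcong_altdef by (auto simp: mult.commute)
    qed
  next
    assume b: "\<forall>j. \<exists>m::int. ?b j = of_int (int s * j + ?k + int t * m)"
    have "\<exists>m::int. a i = of_int (i + int t * m)" for i
    proof -
      obtain j where j: "[i = int s * j + ?k] (mod int t)" using shift_surj cong_sym by metis
      obtain m where m: "?b j = of_int (int s * j + ?k + int t * m)" using b by blast
      obtain m' where "int s * j + ?k = i + int t * m'" using j by (auto simp: cong_iff_lin)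
      then have "a i = of_int (i + int t * (m' + m))"
        using m cyc_cong[OF cyc j] unfolding b_coords_def by (simp add: algebra_simps)
      then show ?thesis by blast
    qed
    then have "a i \<in> \<int> \<and> [a i = of_int i] (rmod real t)" for i
      by (metis Ints_of_int add.commute mult.commute of_int_add of_int_mult of_int_of_nat_eq
          rcong_altdef rcong_sym)
    then show "a \<in> a_lattice t" using H unfolding a_lattice_def by blast
  qed
  have z_iff: "?z \<in> z_lattice s t \<longleftrightarrow> (\<forall>j. ?z j \<in> \<int>) \<and> (\<exists>m::int. ?J = of_int (int t * m))"
  proof -
    have "[?J = 0] (rmod real t) \<longleftrightarrow> [0 = ?J] (rmod real t)" by (rule rcong_sym_iff)
    also have "\<dots> \<longleftrightarrow> (\<exists>m::int. ?J = of_int (int t * m))"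
      unfolding rcong_altdef by (simp add: mult.commute)
    finally have "[?J = 0] (rmod real t) \<longleftrightarrow> (\<exists>m::int. ?J = of_int (int t * m))" .
    then show ?thesis using zH unfolding z_lattice_def by simp
  qed
  show ?thesis unfolding a_iff z_iff
  proof
    assume z: "(\<forall>j. ?z j \<in> \<int>) \<and> (\<exists>m::int. ?J = of_int (int t * m))"
    then obtain c where c: "\<And>j. ?z j = real_of_int (c j)" by (metis Ints_cases)
    show "\<forall>j. \<exists>m::int. ?b j = of_int (int s * j + ?k + int t * m)"
    proof
      fix j
      show "\<exists>m::int. ?b j = of_int (int s * j + ?k + int t * m)"
      \<comment> \<open>Index 0 is settled by the congruence on \<open>z\<close>; each integral
        \<open>z j\<close> then carries the congruence from \<open>j\<close> to \<open>j + 1\<close>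
        and back, which is why the induction runs in both directions.\<close>
      proof (induction j rule: int_induct[where k = 0])
        case base
        obtain m where "?J = of_int (int t * m)" using z by blast
        then have "?b 0 = of_int (int s * 0 + ?k + int t * (- m))" using zero by simp
        then show ?case by blast
      next
        case (step1 j)
        then obtain m where m: "?b j = of_int (int s * j + ?k + int t * m)" by blast
        then have "?b (j + 1) = of_int (int s * (j + 1) + ?k + int t * (m - c j))"
          using diff[of j] c[of j] by (simp add: algebra_simps)
        then show ?case by blast
      next
        case (step2 j)
        then obtain m where m: "?b j = of_int (int s * j + ?k + int t * m)" by blast
        then have "?b (j - 1) = of_int (int s * (j - 1) + ?k + int t * (m + c (j - 1)))"
          using diff[of "j - 1"] c[of "j - 1"] by (simp add: algebra_simps)
        then show ?case by blast
      qed
    qed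
  next
    assume "\<forall>j. \<exists>m::int. ?b j = of_int (int s * j + ?k + int t * m)"
    then obtain m where m: "\<And>j. ?b j = of_int (int s * j + ?k + int t * m j)" by metis
    \<comment> \<open>The contributions \<open>s * j\<close> and \<open>s * (j + 1)\<close> differ
      by exactly the \<open>s\<close> added in the change of variables, so only multiples of
      \<open>t\<close> remain.\<close>
    have "?z j = of_int (m j - m (j + 1))" for j
    proof -
      have "real t * ?z j = real t * of_int (m j - m (j + 1))"
        using diff[of j] m[of j] m[of "j + 1"] by (simp add: algebra_simps)
      then show ?thesis using t by simp
    qed
    moreover have "?J = of_int (int t * (- m 0))" using zero m[of 0] by simp
    ultimately show "(\<forall>j. ?z j \<in> \<int>) \<and> (\<exists>m::int. ?J = of_int (int t * m))"
      by (metis Ints_of_int)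
  qed
qed

lemma z_map_lattice_bij: "bij_betw (z_map s t) (a_lattice t) (z_lattice s t)"
proof -
  have "bij_betw (z_map s t) {a \<in> a_hyperplane t. a \<in> a_lattice t}
     {z \<in> z_hyperplane s t. z \<in> z_lattice s t}"
    by (rule bij_betw_Collect[OF z_map_bij]) (simp add: z_map_lattice_iff)
  then show ?thesis unfolding a_lattice_def z_lattice_def by (simp add: conj_ac cong: conj_cong)
qed

lemma z_map_A_set_bij: "bij_betw (z_map s t) (A_set s t) (TD_set s t)"
proof -
  have "bij_betw (z_map s t) {a \<in> a_lattice t. a \<in> a_simplex s t}
     {z \<in> z_lattice s t. z \<in> z_simplex s t}"
    by (rule bij_betw_Collect[OF z_map_lattice_bij]) (simp add: z_map_simplex_iff a_lattice_def)
  then show ?thesis unfolding A_set_def TD_set_def by (simp add: Int_def)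
qed

end


section \<open>Coordinates of cores\<close>

text \<open>\<open>GREATEST\<close> is meaningful only once a maximum is known to exist. The class
  is unbounded below inside the beta-set, so it is truncated at some member \<open>x0\<close>; the
  rest is finite and its \<open>Max\<close> is the maximum of the whole class.\<close>

lemma a_coord_props:
  assumes l: "l \<in> partitions" and t: "t \<ge> 1"
  shows "a_coord t l i - int t \<in> beta_set l" "[a_coord t l i = i] (mod int t)"
    and "\<And>x. x \<in> beta_set l \<Longrightarrow> [x = i] (mod int t) \<Longrightarrow> x \<le> a_coord t l i - int t"
proof -
  obtain N where N: "\<And>i. i > N \<Longrightarrow> l i = 0" using partitions_eventually_zero[OF l] by blast
  \<comment> \<open>A member of the class of \<open>i\<close> that lies below \<open>- N\<close>,
    hence in the beta-set; \<open>t \<ge> 1\<close> makes the subtracted multiple large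
    enough.\<close>
  define x0 where "x0 = i - int t * (\<bar>i\<bar> + int N + 1)"
  have "int t * (\<bar>i\<bar> + int N + 1) \<ge> \<bar>i\<bar> + int N + 1"
    using t mult_right_mono[of 1 "int t" "\<bar>i\<bar> + int N + 1"] by simp
  moreover have "i - T < - int N" if "\<bar>i\<bar> + int N + 1 \<le> T" for T
    using that by linarith
  ultimately have "x0 < - int N" unfolding x0_def by blast
  then have "x0 \<in> beta_set l" using N by (intro beta_set_lower[of N]) auto
  moreover have x0c: "[x0 = i] (mod int t)" unfolding x0_def by (simp add: cong_iff_dvd_diff)
  define X where "X = {x \<in> beta_set l. [x = i] (mod int t) \<and> x0 \<le> x}"
  have "X \<subseteq> {x0..int (l 1)}" using beta_set_upper[OF l] unfolding X_def by fastforce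
  then have fin: "finite X" by (rule finite_subset) simp
  have ne: "x0 \<in> X" using calculation x0c unfolding X_def by simp
  have max: "Max X \<in> X" using Max_in[OF fin] ne by blast
  have ub: "x \<le> Max X" if "x \<in> beta_set l \<and> [x = i] (mod int t)" for x
  proof (cases "x0 \<le> x")
    case True
    then show ?thesis using that Max_ge[OF fin] unfolding X_def by blast
  next
    case False
    then show ?thesis using Max_ge[OF fin ne] by linarith
  qed
  have "(GREATEST x. x \<in> beta_set l \<and> [x = i] (mod int t)) = Max X"
    using max ub unfolding X_def by (intro Greatest_equality) auto
  then have a: "a_coord t l i = int t + Max X" unfolding a_coord_def by simp
  show "a_coord t l i - int t \<in> beta_set l" "[a_coord t l i = i] (mod int t)"
    using max unfolding a X_def by (auto simp: cong_def)
  show "x \<le> a_coord t l i - int t" if "x \<in> beta_set l" "[x = i] (mod int t)" for x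
    using ub that unfolding a by simp
qed

lemma a_coord_periodic: "a_coord t l (i + int t) = a_coord t l i"
  unfolding a_coord_def by (simp add: cong_def)

lemma diff_multiple_mem:
  assumes "\<And>x. x \<in> B \<Longrightarrow> x - int t \<in> B" "x \<in> B"
  shows "x - int t * int n \<in> B"
proof (induction n)
  case (Suc n)
  have eq: "x - int t * int (Suc n) = (x - int t * int n) - int t" by (simp add: algebra_simps)
  show ?case unfolding eq by (rule assms(1)[OF Suc])
qed (use assms(2) in simp)

text \<open>The coordinate is one step of \<open>t\<close> above the maximum of its class, and
  closure under subtracting \<open>t\<close> fills the class below that maximum.\<close>

lemma mem_beta_set_iff_less_a_coord:
  assumes l: "l \<in> cores t" and t: "t \<ge> 1"
  shows "x \<in> beta_set l \<longleftrightarrow> x < a_coord t l x"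
proof -
  have lp: "l \<in> partitions" and down: "\<And>x. x \<in> beta_set l \<Longrightarrow> x - int t \<in> beta_set l"
    using l cores_iff_beta_set[OF t] by blast+
  show ?thesis
  proof
    assume "x \<in> beta_set l"
    then show "x < a_coord t l x" using a_coord_props(3)[OF lp t, of x x] t by simp
  next
    assume less: "x < a_coord t l x"
    obtain m where m: "a_coord t l x = x + int t * m"
      using a_coord_props(2)[OF lp t, of x] by (metis cong_iff_lin cong_sym)
    \<comment> \<open>The maximum is at \<open>a_coord t l x - t\<close>, so \<open>x\<close> lies
      \<open>m - 1\<close> steps below it.\<close>
    then have "m \<ge> 1" using less by (simp add: zero_less_mult_iff)
    then have "x = (a_coord t l x - int t) - int t * int (nat (m - 1))"
      using m by (simp add: algebra_simps)
    then show "x \<in> beta_set l"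
      using diff_multiple_mem[OF down a_coord_props(1)[OF lp t]] by metis
  qed
qed

section \<open>Sets described by a height in each residue class\<close>

text \<open>\<open>a i\<close> is the least element of the class of \<open>i\<close> outside of the set \<open>{x. x < a x}\<close>.\<close>

locale residue_heights =
  fixes t :: nat and a :: "int \<Rightarrow> int"
  assumes t: "t \<ge> 1"
    and periodic: "\<And>i. a (i + int t) = a i"
    and cong: "\<And>i. [a i = i] (mod int t)"
begin

lemma cyc: "(\<lambda>i. real_of_int (a i)) \<in> cyc t"
  unfolding cyc_def using periodic by simp

lemma cong_eq: "[i = j] (mod int t) \<Longrightarrow> a i = a j"
  using cyc_cong[OF cyc] by simp

lemma finite_window: "finite {x. m \<le> x \<and> x < a x}"
proof (rule finite_subset)
  show "{x. m \<le> x \<and> x < a x} \<subseteq> {m..Max (a ` {0..<int t})}"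
  proof
    fix x assume x: "x \<in> {x. m \<le> x \<and> x < a x}"
    have "a x = a (x mod int t)" by (rule cong_eq) (simp add: cong_def)
    also have "\<dots> \<le> Max (a ` {0..<int t})" using t by (intro Max_ge) auto
    finally show "x \<in> {m..Max (a ` {0..<int t})}" using x by simp
  qed
qed simp

text \<open>The window starts at a multiple of \<open>t\<close>, so that each class meets it in the same number of
  negative elements.\<close>

lemma card_window:
  assumes low: "\<And>x. x < - int (N * t) \<Longrightarrow> x < a x"
  shows "int t * int (card {x. - int (N * t) \<le> x \<and> x < a x})
    = (\<Sum>i\<in>{0..<int t}. a i) - int (t choose 2) + int t * int (N * t)"
proof -
  define q where "q i = (a i - i) div int t" for i
  have q: "a i = i + int t * q i" for i
    using cong[of i] unfolding q_def by (simp add: cong_iff_dvd_diff)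
  have q_ge: "- int N \<le> q i" if "i \<in> {0..<int t}" for i
  proof -
    \<comment> \<open>The member of the class of \<open>i\<close> just below the window, because
      \<open>i < t\<close>.\<close>
    have "i - int t * (int N + 1) < a (i - int t * (int N + 1))"
      using that by (intro low) (simp add: algebra_simps)
    also have "\<dots> = a i" by (rule cong_eq) (simp add: cong_iff_dvd_diff)
    finally have "int t * (- (int N + 1)) < int t * q i" unfolding q[of i] by (simp add: algebra_simps)
    then show ?thesis using t by (simp add: mult_less_cancel_left)
  qed
  \<comment> \<open>Division with remainder arranges the window as an abacus with \<open>t\<close>
    runners; runner \<open>i\<close> is filled from \<open>- N\<close> up to just below
    \<open>q i\<close>.\<close>
  have "card {x. - int (N * t) \<le> x \<and> x < a x} = card (SIGMA i:{0..<int t}. {- int N..<q i})"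
  proof (rule bij_betw_same_card, rule bij_betw_byWitness)
    let ?f = "\<lambda>x. (x mod int t, x div int t)" and ?g = "\<lambda>(i, m). i + int t * m"
    have in_window: "i + int t * m \<in> {x. - int (N * t) \<le> x \<and> x < a x} \<longleftrightarrow> m \<in> {- int N..<q i}"
      if i: "i \<in> {0..<int t}" for i m
    proof -
      have "a (i + int t * m) = i + int t * q i"
        using cong_eq[of "i + int t * m" i] q[of i] by (simp add: cong_def)
      moreover have "- int (N * t) \<le> i + int t * m \<longleftrightarrow> - int N \<le> m"
      proof
        assume "- int (N * t) \<le> i + int t * m"
        then have "int t * (- int N - 1) < int t * m" using i by (simp add: algebra_simps)
        then show "- int N \<le> m" using t by (simp add: mult_less_cancel_left)
      next
        assume "- int N \<le> m"
        then have "int t * (- int N) \<le> int t * m" by (intro mult_left_mono) auto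
        then show "- int (N * t) \<le> i + int t * m" using i by (simp add: algebra_simps)
      qed
      ultimately show ?thesis using t by (simp add: mult_less_cancel_left)
    qed
    show "\<forall>x\<in>{x. - int (N * t) \<le> x \<and> x < a x}. ?g (?f x) = x" by simp
    show "\<forall>p\<in>(SIGMA i:{0..<int t}. {- int N..<q i}). ?f (?g p) = p" using t by auto
    show "?f ` {x. - int (N * t) \<le> x \<and> x < a x} \<subseteq> (SIGMA i:{0..<int t}. {- int N..<q i})"
    proof
      fix p assume "p \<in> ?f ` {x. - int (N * t) \<le> x \<and> x < a x}"
      then obtain x where x: "x \<in> {x. - int (N * t) \<le> x \<and> x < a x}" "p = ?f x" by blast
      have "x mod int t \<in> {0..<int t}" using t by simp
      then show "p \<in> (SIGMA i:{0..<int t}. {- int N..<q i})"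
        using in_window[of "x mod int t" "x div int t"] x by (metis SigmaI mod_mult_div_eq)
    qed
    show "?g ` (SIGMA i:{0..<int t}. {- int N..<q i}) \<subseteq> {x. - int (N * t) \<le> x \<and> x < a x}"
    proof (rule image_subsetI)
      fix p assume "p \<in> (SIGMA i:{0..<int t}. {- int N..<q i})"
      then obtain i m where p: "p = (i, m)" and "i \<in> {0..<int t}" "m \<in> {- int N..<q i}"
        by (rule SigmaE)
      then have "i + int t * m \<in> {x. - int (N * t) \<le> x \<and> x < a x}" by (simp only: in_window)
      then show "?g p \<in> {x. - int (N * t) \<le> x \<and> x < a x}" unfolding p by (simp only: prod.case)
    qed
  qed
  then have "int (card {x. - int (N * t) \<le> x \<and> x < a x})
      = (\<Sum>i\<in>{0..<int t}. int (card {- int N..<q i}))"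
    by (simp add: card_SigmaI)
  \<comment> \<open>Here \<open>q_ge\<close> matters: a smaller \<open>q i\<close> would give an
    empty interval instead of one with \<open>q i + N\<close> elements.\<close>
  also have "\<dots> = (\<Sum>i\<in>{0..<int t}. q i + int N)"
    using q_ge by (intro sum.cong refl) fastforce
  finally have "int (card {x. - int (N * t) \<le> x \<and> x < a x}) = (\<Sum>i\<in>{0..<int t}. q i + int N)" .
  then have "int t * int (card {x. - int (N * t) \<le> x \<and> x < a x})
    = (\<Sum>i\<in>{0..<int t}. (a i - i) + int t * int N)"
    by (simp add: sum_distrib_left distrib_left q)
  also have "\<dots> = (\<Sum>i\<in>{0..<int t}. a i) - int (t choose 2) + int t * int (N * t)"
    by (simp add: sum.distrib sum_subtractf flip: sum_int_eq_choose_two)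
  finally show ?thesis .
qed

text \<open>Closure is tested at the top element \<open>a (i + s) - t\<close> of a class. Its
  translate lies below \<open>a i\<close> and is congruent to it, hence at least \<open>t\<close>
  below, and the two \<open>t\<close> cancel.\<close>

lemma down_closed_iff:
  "(\<forall>x. x < a x \<longrightarrow> x - int s < a (x - int s)) \<longleftrightarrow> (\<forall>i. a (i + int s) - int s \<le> a i)"
proof
  assume closed: "\<forall>x. x < a x \<longrightarrow> x - int s < a (x - int s)"
  show "\<forall>i. a (i + int s) - int s \<le> a i"
  proof
    fix i
    let ?x = "a (i + int s) - int t"
    have xc: "[?x = i + int s] (mod int t)" using cong[of "i + int s"] by (simp add: cong_def)
    then have "a ?x = a (i + int s)" by (rule cong_eq)
    then have "?x < a ?x" using t by simp
    then have "?x - int s < a (?x - int s)" using closed by blast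
    moreover have xs: "[?x - int s = i] (mod int t)" using cong_diff[OF xc, of "int s" "int s"] by simp
    then have "a (?x - int s) = a i" by (rule cong_eq)
    ultimately have less: "?x - int s < a i" by simp
    have "[?x - int s = a i] (mod int t)" using xs cong[of i] cong_trans cong_sym by blast
    then obtain m where m: "a i = ?x - int s + int t * m" by (auto simp: cong_iff_lin)
    then have "m \<ge> 1" using less by (simp add: zero_less_mult_iff)
    then have "int t * m \<ge> int t" using t by simp
    then show "a (i + int s) - int s \<le> a i" using m by simp
  qed
next
  assume "\<forall>i. a (i + int s) - int s \<le> a i"
  then have "a x - int s \<le> a (x - int s)" for x by (metis diff_add_cancel)
  then show "\<forall>x. x < a x \<longrightarrow> x - int s < a (x - int s)" by (meson diff_right_mono le_less_trans less_le_trans diff_strict_right_mono)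
qed

end

section \<open>The bijections between cores and lattice points\<close>

lemma a_coord_residue_heights:
  assumes "l \<in> partitions" "t \<ge> 1"
  shows "residue_heights t (a_coord t l)"
  using a_coord_props(2)[OF assms] a_coord_periodic assms(2) by unfold_locales auto

text \<open>The same window is counted twice, by the indices of the parts and by residue classes.
  Its bound is enlarged from \<open>N\<close> to \<open>N * t\<close> to start at a multiple of
  \<open>t\<close>.\<close>

lemma sum_a_coord:
  assumes l: "l \<in> cores t" and t: "t \<ge> 1"
  shows "(\<Sum>i\<in>{0..<int t}. a_coord t l i) = int (t choose 2)"
proof -
  have lp: "l \<in> partitions" using l unfolding cores_def by simp
  obtain N where N: "\<And>i. i > N \<Longrightarrow> l i = 0" using partitions_eventually_zero[OF lp] by blast
  have NN: "l i = 0" if "i > N * t" for i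
  proof (rule N)
    show "N < i" using that t by (metis le_less_trans mult_le_mono2 nat_mult_1_right)
  qed
  have "card {x \<in> beta_set l. - int (N * t) \<le> x} = N * t"
    by (rule card_beta_set_window[OF lp]) (rule NN)
  then have "card {x. - int (N * t) \<le> x \<and> x < a_coord t l x} = N * t"
    unfolding mem_beta_set_iff_less_a_coord[OF l t] by (simp only: conj_commute)
  moreover have "x < a_coord t l x" if "x < - int (N * t)" for x
    unfolding mem_beta_set_iff_less_a_coord[OF l t, symmetric]
    by (rule beta_set_lower[OF _ that]) (rule NN)
  ultimately show ?thesis
    using residue_heights.card_window[OF a_coord_residue_heights[OF lp t], of N] by simp
qed

lemma a_lattice_iff:
  "(\<lambda>i. real_of_int (a i)) \<in> a_lattice t \<longleftrightarrow>
    (\<forall>i. a (i + int t) = a i) \<and> (\<forall>i. [a i = i] (mod int t))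
    \<and> (\<Sum>i\<in>{0..<int t}. a i) = int (t choose 2)"
proof -
  have "[real_of_int (a i) = of_int i] (rmod real t) \<longleftrightarrow> [a i = i] (mod int t)" for i
  proof -
    have "real_of_int i = of_int (a i) + of_int n * real t \<longleftrightarrow> i = a i + int t * n" for n
    proof -
      have "real_of_int i = of_int (a i) + of_int n * real t
        \<longleftrightarrow> real_of_int i = of_int (a i + int t * n)"
        by (simp add: mult.commute)
      then show ?thesis by (simp only: of_int_eq_iff)
    qed
    then show ?thesis unfolding rcong_altdef cong_iff_lin by blast
  qed
  moreover have "(\<Sum>i\<in>{0..<int t}. real_of_int (a i)) = real (t choose 2)
    \<longleftrightarrow> (\<Sum>i\<in>{0..<int t}. a i) = int (t choose 2)"
    by (metis of_int_eq_iff of_int_of_nat_eq of_int_sum)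
  ultimately show ?thesis unfolding a_lattice_def a_hyperplane_def cyc_def by auto
qed

text \<open>The heights determine the beta-set and thereby the partition. Conversely, the prescribed
  sum gives the set below the heights the element count required by
  \<open>partition_of_beta_set\<close>.\<close>

lemma a_coords_lattice_bij:
  assumes t: "t \<ge> 1"
  shows "bij_betw (a_coords t) (cores t) (a_lattice t)"
  unfolding bij_betw_def
proof
  show "inj_on (a_coords t) (cores t)"
  proof (rule inj_onI)
    fix l m assume l: "l \<in> cores t" and m: "m \<in> cores t" and eq: "a_coords t l = a_coords t m"
    then have "a_coord t l x = a_coord t m x" for x
      unfolding a_coords_def by (metis of_int_eq_iff)
    then have "beta_set l = beta_set m"
      using mem_beta_set_iff_less_a_coord[OF l t] mem_beta_set_iff_less_a_coord[OF m t] by auto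
    then show "l = m" using beta_set_inject l m unfolding cores_def by blast
  qed
  show "a_coords t ` cores t = a_lattice t"
  proof (intro set_eqI iffI)
    fix a assume "a \<in> a_coords t ` cores t"
    then obtain l where l: "l \<in> cores t" "a = a_coords t l" by blast
    then have "l \<in> partitions" unfolding cores_def by simp
    then show "a \<in> a_lattice t"
      using a_coord_props(2)[OF _ t] a_coord_periodic sum_a_coord[OF l(1) t]
      unfolding l(2) a_coords_def a_lattice_iff by blast
  next
    fix r assume r: "r \<in> a_lattice t"
    then have "\<forall>i. \<exists>n::int. r i = of_int n" unfolding a_lattice_def by (blast elim: Ints_cases)
    then obtain a where a: "r = (\<lambda>i. real_of_int (a i))" by metis
    have props: "\<And>i. a (i + int t) = a i" "\<And>i. [a i = i] (mod int t)"
        "(\<Sum>i\<in>{0..<int t}. a i) = int (t choose 2)"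
      using r unfolding a a_lattice_iff by blast+
    interpret residue_heights t a using t props by unfold_locales
    define B where "B = {x. x < a x}"
    \<comment> \<open>Chosen so that no height is below \<open>- N\<close>; everything below
      \<open>- N * t\<close> then lies under its height.\<close>
    define N where "N = nat (Max ((\<lambda>i. - a i) ` {0..<int t}))"
    have N: "- int N \<le> a x" for x
    proof -
      have "a x = a (x mod int t)" by (rule cong_eq) (simp add: cong_def)
      moreover have "- a (x mod int t) \<le> Max ((\<lambda>i. - a i) ` {0..<int t})"
        using t by (intro Max_ge) auto
      ultimately show ?thesis unfolding N_def by linarith
    qed
    have low: "x < a x" if "x < - int (N * t)" for x
    proof -
      have "N * 1 \<le> N * t" using t by (rule mult_le_mono2)
      then have "int N \<le> int (N * t)" by (simp only: of_nat_le_iff mult_1_right)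
      then show ?thesis using that N[of x] by linarith
    qed
    have "int t * int (card {x. - int (N * t) \<le> x \<and> x < a x}) = int t * int (N * t)"
      using card_window[OF low] props(3) by simp
    then have "card {x. - int (N * t) \<le> x \<and> x < a x} = N * t"
      using t by (simp del: of_nat_mult)
    then have card: "card {x \<in> B. - int (N * t) \<le> x} = N * t"
      unfolding B_def by (simp add: conj_commute)
    have "finite {x \<in> B. - int (N * t) \<le> x}"
      using finite_window[of "- int (N * t)"] unfolding B_def by (simp add: conj_commute)
    then obtain l where l: "l \<in> partitions" "beta_set l = B"
      using partition_of_beta_set[of "N * t" B] low card unfolding B_def by blast
    have "x - int t \<in> B" if "x \<in> B" for x
      using that periodic[of "x - int t"] unfolding B_def by simp
    then have core: "l \<in> cores t" using l cores_iff_beta_set[OF t] by blast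
    \<comment> \<open>In the class of \<open>i\<close> the largest element of \<open>B\<close> is
      \<open>a i - t\<close>, so the constructed core has the given heights as coordinates.\<close>
    have "a_coord t l i = a i" for i
    proof (rule antisym)
      let ?y = "a_coord t l i - int t"
      have "?y < a ?y" using a_coord_props(1)[OF l(1) t, of i] unfolding l(2) B_def by simp
      moreover have yc: "[?y = i] (mod int t)"
        using a_coord_props(2)[OF l(1) t, of i] by (simp add: cong_def)
      then have "a ?y = a i" by (rule cong_eq)
      ultimately have less: "?y < a i" by simp
      obtain m where m: "a i = ?y + int t * m"
        using yc cong[of i] by (metis cong_iff_lin cong_sym cong_trans)
      then have "m \<ge> 1" using less by (simp add: zero_less_mult_iff)
      then have "int t * m \<ge> int t" using t by simp
      then show "a_coord t l i \<le> a i" using m by simp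
    next
      let ?x = "a i - int t"
      have xc: "[?x = i] (mod int t)" using cong[of i] by (simp add: cong_def)
      then have "a ?x = a i" by (rule cong_eq)
      then have "?x \<in> beta_set l" using t unfolding l(2) B_def by simp
      then show "a i \<le> a_coord t l i" using a_coord_props(3)[OF l(1) t _ xc] by simp
    qed
    then have "r = a_coords t l" unfolding a a_coords_def by simp
    then show "r \<in> a_coords t ` cores t" using core by blast
  qed
qed

text \<open>The hook criterion for \<open>s\<close> asks for closure under subtracting
  \<open>s\<close>, which \<open>down_closed_iff\<close> expresses through the heights of the
  \<open>t\<close>-core.\<close>

lemma cores_iff_a_simplex:
  assumes l: "l \<in> cores t" and t: "t \<ge> 1" and s: "s \<ge> 1"
  shows "a_coords t l \<in> a_simplex s t \<longleftrightarrow> l \<in> cores s"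
proof -
  have lp: "l \<in> partitions" using l unfolding cores_def by simp
  interpret residue_heights t "a_coord t l" using a_coord_residue_heights[OF lp t] .
  have "a_coords t l \<in> a_lattice t"
    using a_coords_lattice_bij[OF t] l unfolding bij_betw_def by blast
  then have H: "a_coords t l \<in> a_hyperplane t" unfolding a_lattice_def by simp
  have "real_of_int (a_coord t l (i + int s)) - real s \<le> real_of_int (a_coord t l i)
    \<longleftrightarrow> a_coord t l (i + int s) - int s \<le> a_coord t l i" for i
    by linarith
  then have "a_coords t l \<in> a_simplex s t
    \<longleftrightarrow> (\<forall>i. a_coord t l (i + int s) - int s \<le> a_coord t l i)"
    using H unfolding a_simplex_def a_coords_def by simp
  also have "\<dots> \<longleftrightarrow> (\<forall>x\<in>beta_set l. x - int s \<in> beta_set l)"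
    unfolding down_closed_iff[symmetric] mem_beta_set_iff_less_a_coord[OF l t, symmetric] by blast
  also have "\<dots> \<longleftrightarrow> l \<in> cores s" using cores_iff_beta_set[OF s] lp by blast
  finally show ?thesis .
qed

lemma a_coords_A_set_bij:
  assumes t: "t \<ge> 1" and s: "s \<ge> 1"
  shows "bij_betw (a_coords t) (cores s \<inter> cores t) (A_set s t)"
proof -
  have "bij_betw (a_coords t) {l \<in> cores t. l \<in> cores s} {a \<in> a_lattice t. a \<in> a_simplex s t}"
    by (rule bij_betw_Collect[OF a_coords_lattice_bij[OF t]]) (rule cores_iff_a_simplex[OF _ t s])
  then show ?thesis unfolding A_set_def by (simp add: Int_def conj_commute)
qed

theorem proposition4p2:
  fixes s t :: nat
  assumes "s \<ge> 1" and "t \<ge> 1" and "coprime s t"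
  shows
    "(real_of_int (shift s t) = (real s + 1) * (real t - 1) / 2
      \<and> affine_map_on (a_hyperplane t) (z_map s t)
      \<and> bij_betw (z_map s t) (a_hyperplane t) (z_hyperplane s t)
      \<and> is_simplex t (a_simplex s t)
      \<and> is_simplex t (z_simplex s t)
      \<and> z_map s t ` a_simplex s t = z_simplex s t
      \<and> (\<forall>z\<in>z_hyperplane s t. \<forall>l::int.
           the_inv_into (a_hyperplane t) (z_map s t) z (shift s t + l * int s) - (real t - 1) / 2
           = (\<Sum>j\<in>{0..<int t}. ((real t - 1) / 2 - of_int j) * z (j + l))))
     \<and> (bij_betw (a_coords t) (cores s \<inter> cores t) (A_set s t)
      \<and> bij_betw (z_map s t) (A_set s t) (TD_set s t))
     \<and> (bij_betw (a_coords t) (cores t) (a_lattice t)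
      \<and> bij_betw (z_map s t) (a_lattice t) (z_lattice s t))"
proof -
  interpret coprime_pair s t using assms by unfold_locales
  have "z_map s t ` a_simplex s t = z_simplex s t"
    using z_map_simplex_bij unfolding bij_betw_def by blast
  moreover have "the_inv_into (a_hyperplane t) (z_map s t) z (shift s t + l * int s) - (real t - 1) / 2
      = (\<Sum>j\<in>{0..<int t}. ((real t - 1) / 2 - of_int j) * z (j + l))"
    if "z \<in> z_hyperplane s t" for z l
    unfolding z_map_inverse[OF that] b_of_z_def by simp
  ultimately show ?thesis
    using shift_exact affine_z_map z_map_bij a_simplex_simplex z_simplex_simplex
      a_coords_A_set_bij[OF assms(2,1)] z_map_A_set_bij a_coords_lattice_bij[OF assms(2)]
      z_map_lattice_bij
    by blast
qed

end
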